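(* Let $\mathbb B^d$ be the open unit ball of $\mathbb R^d$, $d\ge2$, and let $h$ be a convex function on $\overline{\mathbb B^d}$ whose Monge--Ampère measure satisfies $\mathrm{MA}(h)\ge c_0\mathcal L$ on $\mathbb B^d$ for some $c_0>0$, where $\mathcal L$ is Lebesgue measure. Let $W$ be an affine subspace of $\mathbb R^d$ passing through $0$, of dimension $d-k$, with $k\le d/2$. Suppose that $h\equiv0$ on the boundary (relative to $W$) of the $(d-k)$-dimensional ball $W\cap\mathbb B^d$. Then $h(0)<0$.
   Context: For a convex function $h$ on $\mathbb B^d$, $\partial h(x)=\{p\in\mathbb R^d:h(y)\ge h(x)+\langle p,y-x\rangle\ \forall y\in\mathbb B^d\}$ is the subdifferential, and $\mathrm{MA}(h)(\omega)=\mathcal L\big(\bigcup_{x\in\omega}\partial h(x)\big)$ for Borel $\omega\subset\mathbb B^d$. *)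

theory Defs
  imports "HOL-Analysis.Analysis"
begin

definition subdifferential :: "(real ^ 'd \<Rightarrow> real) \<Rightarrow> real ^ 'd \<Rightarrow> (real ^ 'd) set"
  where "subdifferential h x = {p. \<forall>y\<in>ball 0 1. h y \<ge> h x + p \<bullet> (y - x)}"

text \<open>
  The Monge-Ampere measure is kept as a set function, to be evaluated at Borel subsets of the open
  unit ball. It uses the completed measure \<open>lebesgue\<close> because the gradient image of a Borel set
  under a convex function is Lebesgue measurable but not obviously Borel.
\<close>

definition monge_ampere :: "(real ^ 'd \<Rightarrow> real) \<Rightarrow> (real ^ 'd) set \<Rightarrow> ennreal"
  where "monge_ampere h \<omega> = emeasure lebesgue (\<Union>x\<in>\<omega>. subdifferential h x)"

end

theory Submission
  imports Defs
begin

text \<open>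
  Suppose \<open>h 0 \<ge> 0\<close>. By convexity \<open>h\<close> vanishes on the whole section \<open>W \<inter> ball 0 1\<close>
  (\<open>convex_zero_on_section_if_zero_on_sphere\<close>), and the claim is that its Monge-Ampere measure is
  then too small near \<open>W\<close>. Write \<open>d\<close> for the dimension of the space and \<open>m = dim W \<ge> d - m\<close>, and
  take the prism of points \<open>u + z\<close> with \<open>u\<close> in a fixed cube of \<open>W\<close> and \<open>z\<close> in the cube of width
  \<open>\<epsilon>\<close> orthogonal to \<open>W\<close>. Its volume is of order \<open>\<epsilon> ^ (d - m)\<close>.

  A subgradient at a point of the prism has bounded norm, because \<open>h\<close> is bounded. Its component
  along \<open>W\<close> is much smaller. A Lipschitz bound would only give \<open>O(\<epsilon>)\<close>, which is not enough when
  \<open>d = 2 m\<close>; the point is that it is \<open>o(\<epsilon>)\<close>. Indeed the one-sided derivative of \<open>h\<close> at a point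
  \<open>u\<close> of the section, in a direction \<open>z\<close>, does not depend on \<open>u\<close>. The quantitative form used here
  is \<open>4 h (z/4) \<le> h (u + z) \<le> h (4 z) / 4\<close>
  (\<open>convex_vanishing_on_subspace_oscillation\<close>): both bounds are difference quotients of \<open>h\<close> at the
  origin along the ray of \<open>z\<close>, so their difference is \<open>o(norm z)\<close>, uniformly in the direction
  (\<open>convex_difference_quotient_uniformly_Cauchy\<close>). Hence \<open>h\<close> varies by \<open>o(\<epsilon>)\<close> along translates of
  \<open>W\<close> at distance of order \<open>\<epsilon>\<close>, and this bounds the components of subgradients along \<open>W\<close>.

  So the gradient image of the prism has volume \<open>o(\<epsilon> ^ m)\<close>, which is \<open>o(\<epsilon> ^ (d - m))\<close> since
  \<open>m \<ge> d - m\<close>, in contradiction with \<open>MA(h) \<ge> c\<^sub>0 L\<close>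
  (\<open>monge_ampere_small_if_vanishing_on_subspace\<close>).
\<close>

section \<open>Volumes of boxes in a rotated frame\<close>

text \<open>
  An isometry maps balls to balls of the same radius, so it preserves the measure of every set that
  is a disjoint union of balls up to a null set. By Vitali's covering theorem each open set is one.
\<close>

lemma emeasure_isometry_image_open:
  fixes F :: "'a::euclidean_space \<Rightarrow> 'a"
  assumes F: "orthogonal_transformation F" and "open T"
  shows "emeasure lebesgue (F ` T) = emeasure lebesgue T"
proof -
  \<comment> \<open>The balls inside \<open>T\<close> form a Vitali cover of \<open>T\<close>.\<close>
  define K where "K = {(x::'a, r). 0 < r \<and> ball x r \<subseteq> T}"
  have "\<exists>i. i \<in> K \<and> x \<in> ball (fst i) (snd i) \<and> snd i < d" if "x \<in> T" "0 < d" for x d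
  proof -
    obtain e where e: "e > 0" "ball x e \<subseteq> T"
      using \<open>open T\<close> \<open>x \<in> T\<close> open_contains_ball by blast
    have "(x, min e (d/2)) \<in> K"
      using e that unfolding K_def by (auto simp: subset_iff)
    then show ?thesis
      using e that by (intro exI[of _ "(x, min e (d/2))"]) auto
  qed
  then obtain C where C: "countable C" "C \<subseteq> K"
    and disj: "pairwise (\<lambda>i j. disjnt (ball (fst i) (snd i)) (ball (fst j) (snd j))) C"
    and neg: "negligible (T - (\<Union>i\<in>C. ball (fst i) (snd i)))"
    by (rule Vitali_covering_theorem_balls[of T K fst snd]) auto
  define U where "U = (\<Union>i\<in>C. ball (fst i) (snd i))"
  have "U \<subseteq> T"
    using C(2) unfolding U_def K_def by fastforce
  have lin: "linear F" and inj: "inj F"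
    using F orthogonal_transformation_linear orthogonal_transformation_inj by auto
  have FU: "F ` U = (\<Union>i\<in>C. ball (F (fst i)) (snd i))"
    unfolding U_def by (simp add: image_UN image_orthogonal_transformation_ball[OF F])
  have "U \<in> sets lebesgue" "F ` U \<in> sets lebesgue"
    unfolding U_def FU[unfolded U_def] by (auto intro!: lmeasurable_open borel_open sets_completionI_sets open_UN)
  have null: "T - U \<in> null_sets lebesgue" "F ` (T - U) \<in> null_sets lebesgue"
    using neg negligible_differentiable_image_negligible[OF order_refl neg, of F] lin
    by (auto simp: U_def negligible_iff_null_sets linear_imp_differentiable_on)
  have disjF: "pairwise (\<lambda>i j. disjnt (ball (F (fst i)) (snd i)) (ball (F (fst j)) (snd j))) C"
    using disj inj unfolding pairwise_def disjnt_def image_orthogonal_transformation_ball[OF F, symmetric]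
    by (simp add: image_Int[symmetric])
  have sum_balls: "emeasure lebesgue (\<Union>i\<in>C. ball (c i) (snd i))
      = (\<integral>\<^sup>+ i. emeasure lebesgue (ball (c i) (snd i)) \<partial>count_space C)"
    if "pairwise (\<lambda>i j. disjnt (ball (c i) (snd i)) (ball (c j) (snd j))) C" for c :: "'a \<times> real \<Rightarrow> 'a"
    using that C(1)
    by (intro emeasure_UN_countable) (auto simp: disjoint_family_on_def pairwise_def disjnt_def)
  have "emeasure lebesgue T = emeasure lebesgue (U \<union> (T - U))"
    using \<open>U \<subseteq> T\<close> by (simp add: Un_absorb1)
  also have "\<dots> = emeasure lebesgue U"
    by (intro emeasure_Un_null_set null \<open>U \<in> sets lebesgue\<close>)
  also have "\<dots> = (\<integral>\<^sup>+ i. emeasure lebesgue (ball (fst i) (snd i)) \<partial>count_space C)"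
    unfolding U_def by (rule sum_balls[OF disj])
  also have "\<dots> = (\<integral>\<^sup>+ i. emeasure lebesgue (ball (F (fst i)) (snd i)) \<partial>count_space C)"
  proof (rule nn_integral_cong)
    fix i assume "i \<in> space (count_space C)"
    then have "snd i \<ge> 0" using C by (auto simp: K_def)
    then show "emeasure lebesgue (ball (fst i) (snd i)) = emeasure lebesgue (ball (F (fst i)) (snd i))"
      by (simp add: emeasure_ball)
  qed
  also have "\<dots> = emeasure lebesgue (F ` U)"
    unfolding FU by (rule sum_balls[OF disjF, symmetric])
  also have "\<dots> = emeasure lebesgue (F ` U \<union> F ` (T - U))"
    by (intro emeasure_Un_null_set[symmetric] null \<open>F ` U \<in> sets lebesgue\<close>)
  also have "F ` U \<union> F ` (T - U) = F ` T"
    using \<open>U \<subseteq> T\<close> by auto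
  finally show ?thesis by simp
qed

lemma orthonormal_frame_expand:
  fixes \<beta> :: "'d::finite \<Rightarrow> real ^ 'd"
  assumes "\<And>i. norm (\<beta> i) = 1" and "\<And>i j. i \<noteq> j \<Longrightarrow> orthogonal (\<beta> i) (\<beta> j)"
  shows "(\<Sum>i\<in>UNIV. (\<beta> i \<bullet> x) *\<^sub>R \<beta> i) = x"
proof -
  define A where "A = (\<chi> i. \<beta> i)"
  have "orthogonal_matrix A"
    using assms by (auto simp: orthogonal_matrix_orthonormal_rows A_def row_def)
  then have "x = transpose A *v (A *v x)"
    by (simp add: matrix_vector_mul_assoc orthogonal_matrix)
  also have "\<dots> = (\<Sum>i\<in>UNIV. (\<beta> i \<bullet> x) *\<^sub>R \<beta> i)"
    by (simp add: matrix_transpose_mul vec_eq_iff matrix_vector_mult_def transpose_def A_def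
        inner_vec_def mult.commute)
  finally show ?thesis by simp
qed

text \<open>
  For an orthonormal \<open>\<beta>\<close> this is the open box centred at the origin with half-widths \<open>a\<close> along the
  axes \<open>\<beta> i\<close>.
\<close>

definition frame_box :: "('d \<Rightarrow> real ^ 'd) \<Rightarrow> ('d \<Rightarrow> real) \<Rightarrow> (real ^ 'd) set"
  where "frame_box \<beta> a = {x. \<forall>i. \<bar>\<beta> i \<bullet> x\<bar> < a i}"

lemma open_frame_box: "open (frame_box \<beta> a)"
proof -
  have "open (\<Inter>i\<in>UNIV. {x. \<bar>\<beta> i \<bullet> x\<bar> < a i})"
    by (intro open_INT ballI open_Collect_less continuous_intros) auto
  moreover have "(\<Inter>i\<in>UNIV. {x. \<bar>\<beta> i \<bullet> x\<bar> < a i}) = frame_box \<beta> a"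
    by (auto simp: frame_box_def)
  ultimately show ?thesis by simp
qed

text \<open>
  The map to coordinates with respect to \<open>\<beta>\<close> is an isometry that sends this box to an axis-parallel
  one.
\<close>

lemma emeasure_frame_box:
  fixes \<beta> :: "'d::finite \<Rightarrow> real ^ 'd" and a :: "'d \<Rightarrow> real"
  assumes \<beta>: "\<And>i. norm (\<beta> i) = 1" "\<And>i j. i \<noteq> j \<Longrightarrow> orthogonal (\<beta> i) (\<beta> j)"
    and a: "\<And>i. 0 < a i"
  shows "emeasure lebesgue (frame_box \<beta> a) = ennreal (\<Prod>i\<in>UNIV. 2 * a i)"
proof -
  define R where "R = (\<lambda>x. (\<chi> i. \<beta> i) *v x)"
  have R: "orthogonal_transformation R"
    using \<beta> unfolding R_def orthogonal_transformation_matrix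
    by (auto simp: orthogonal_matrix_orthonormal_rows row_def)
  have Rx: "R x $ i = \<beta> i \<bullet> x" for x i
    by (simp add: R_def matrix_vector_mult_def inner_vec_def)
  let ?b = "box (- (\<chi> i. a i)) (\<chi> i. a i)"
  have surj: "surj R"
    using R orthogonal_transformation_surj by auto
  have mem: "R x \<in> ?b \<longleftrightarrow> (\<forall>i. \<bar>\<beta> i \<bullet> x\<bar> < a i)" for x
    unfolding mem_box_cart Rx abs_less_iff by (simp add: minus_less_iff conj_commute)
  have "R -` ?b = frame_box \<beta> a"
    unfolding vimage_def mem frame_box_def ..
  then have "?b = R ` (frame_box \<beta> a)"
    using surj by (metis surj_image_vimage_eq)
  then have "emeasure lebesgue (frame_box \<beta> a) = emeasure lebesgue ?b"
    using emeasure_isometry_image_open[OF R open_frame_box] by simp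
  also have "\<dots> = ennreal (measure lebesgue ?b)"
    by (rule emeasure_eq_ennreal_measure) (simp add: emeasure_lborel_box_eq)
  also have "measure lebesgue ?b = measure lborel (cbox (- (\<chi> i. a i)) (\<chi> i. a i))"
    by (simp add: measure_lborel_box_eq measure_lborel_cbox_eq)
  also have "\<dots> = (\<Prod>i\<in>UNIV. 2 * a i)"
    using a by (subst content_cbox_cart) (simp_all add: interval_ne_empty_cart less_imp_le order_trans[of _ 0])
  finally show "emeasure lebesgue (frame_box \<beta> a) = ennreal (\<Prod>i\<in>UNIV. 2 * a i)" .
qed

text \<open>
  The frame joins an orthonormal basis of \<open>W\<close> to one of its orthogonal complement; \<open>I\<close> indexes the
  vectors of the former.
\<close>

lemma orthonormal_frame_adapted_to_subspace:
  fixes W :: "(real ^ 'd::finite) set"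
  assumes "subspace W"
  obtains \<beta> :: "'d \<Rightarrow> real ^ 'd" and I where "\<And>i. norm (\<beta> i) = 1"
    "\<And>i j. i \<noteq> j \<Longrightarrow> orthogonal (\<beta> i) (\<beta> j)" "\<And>i. i \<in> I \<Longrightarrow> \<beta> i \<in> W" "card I = dim W"
proof -
  define V where "V = {y. \<forall>x\<in>W. orthogonal x y}"
  have V: "subspace V" 
    unfolding V_def by (auto simp: subspace_def orthogonal_clauses)
  have dV: "dim V + dim W = CARD('d)"
    using dim_subspace_orthogonal_to_vectors[of W UNIV] assms by (simp add: V_def)
  obtain B where B: "B \<subseteq> W" "pairwise orthogonal B" "\<And>x. x \<in> B \<Longrightarrow> norm x = 1"
     "independent B" "card B = dim W" 
    using orthonormal_basis_subspace[OF assms] by metis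
  obtain B' where B': "B' \<subseteq> V" "pairwise orthogonal B'" "\<And>x. x \<in> B' \<Longrightarrow> norm x = 1"
     "independent B'" "card B' = dim V" 
    using orthonormal_basis_subspace[OF V] by metis
  have fin: "finite B" "finite B'"
    using B(4) B'(4) independent_imp_finite by blast+
  have orth: "orthogonal x y" if "x \<in> B" "y \<in> B'" for x y
    using that B(1) B'(1) by (auto simp: V_def)
  have "B \<inter> B' = {}"
    using orth B(3) by (force simp: orthogonal_self)
  then have card: "card (B \<union> B') = CARD('d)"
    using fin B(5) B'(5) dV by (simp add: card_Un_disjoint)
  obtain \<beta> where \<beta>: "bij_betw \<beta> (UNIV :: 'd set) (B \<union> B')"
    using finite_same_card_bij[of "UNIV :: 'd set" "B \<union> B'"] card fin by auto
  show ?thesis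
  proof
    have mem: "\<beta> i \<in> B \<union> B'" for i using \<beta> by (auto simp: bij_betw_def)
    show "norm (\<beta> i) = 1" for i using mem[of i] B(3) B'(3) by auto
    show "orthogonal (\<beta> i) (\<beta> j)" if "i \<noteq> j" for i j
    proof -
      have "\<beta> i \<noteq> \<beta> j" using \<beta> that by (auto simp: bij_betw_def inj_on_def)
      then show ?thesis
        using mem[of i] mem[of j] B(2) B'(2) orth orthogonal_commute
        unfolding pairwise_def by blast
    qed
    show "\<beta> i \<in> W" if "i \<in> \<beta> -` B" for i using that B(1) by auto
    have "\<beta> ` (\<beta> -` B) = B" using \<beta> by (auto simp: bij_betw_def)
    moreover have "inj_on \<beta> (\<beta> -` B)" using \<beta> by (auto simp: bij_betw_def inj_on_def)
    ultimately show "card (\<beta> -` B) = dim W" by (metis B(5) card_image)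
  qed
qed

section \<open>Uniform one-sided differentiability of convex functions\<close>

lemma convex_bounded_half_ball:
  fixes f :: "'a::euclidean_space \<Rightarrow> real"
  assumes "convex_on (ball 0 1) f"
  obtains M where "M > 0" "\<And>x. norm x \<le> 1/2 \<Longrightarrow> \<bar>f x\<bar> \<le> M"
proof -
  have "cball (0::'a) (1/2) \<subseteq> ball 0 1" by auto
  with convex_on_continuous[OF open_ball assms] have "continuous_on (cball 0 (1/2)) f"
    by (rule continuous_on_subset)
  then have "bounded (f ` cball 0 (1/2))"
    by (intro compact_imp_bounded compact_continuous_image compact_cball)
  then obtain M where "M > 0" "\<forall>y\<in>f ` cball 0 (1/2). norm y \<le> M"
    unfolding bounded_pos by blast
  then show thesis by (intro that[of M]) auto
qed

lemma convex_bounded_imp_Lipschitz: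
  fixes f :: "'a::euclidean_space \<Rightarrow> real"
  assumes f: "convex_on (ball 0 1) f"
    and M: "\<And>x. norm x \<le> 1/2 \<Longrightarrow> \<bar>f x\<bar> \<le> M"
    and xy: "norm x \<le> 1/4" "norm y \<le> 1/4"
  shows "\<bar>f x - f y\<bar> \<le> 8 * M * norm (x - y)"
proof -
  have "f y - f x \<le> 8 * M * norm (y - x)" if "norm x \<le> 1/4" "norm y \<le> 1/4" "x \<noteq> y" for x y
  proof -
    define s where "s = norm (y - x)"
    \<comment> \<open>Prolong the segment from \<open>x\<close> to \<open>y\<close> by \<open>1/4\<close> to \<open>w\<close>, which stays in the ball of radius \<open>1/2\<close>
      where \<open>f\<close> is bounded; \<open>t\<close> is the position of \<open>y\<close> on the segment from \<open>x\<close> to \<open>w\<close>.\<close>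
    define t where "t = 4 * s / (4 * s + 1)"
    define w where "w = y + (1 / (4 * s)) *\<^sub>R (y - x)"
    have s: "s > 0" using that by (simp add: s_def)
    have t: "0 < t" "t \<le> 1" "t \<le> 4 * s" "t * (1 + 1 / (4 * s)) = 1"
    proof -
      have "4 * s + 1 > 0" using s by simp
      then show "0 < t" "t \<le> 1" "t \<le> 4 * s" using s by (simp_all add: t_def divide_le_eq mult_le_cancel_left1)
      have "1 + 1 / (4 * s) = (4 * s + 1) / (4 * s)" using s by (simp add: add_divide_distrib)
      then show "t * (1 + 1 / (4 * s)) = 1" using s \<open>4 * s + 1 > 0\<close> by (simp add: t_def)
    qed
    have "norm w \<le> norm y + norm ((1 / (4 * s)) *\<^sub>R (y - x))"
      unfolding w_def by (rule norm_triangle_ineq)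
    also have "norm ((1 / (4 * s)) *\<^sub>R (y - x)) = 1/4"
      using s by (simp add: s_def)
    finally have w: "norm w \<le> 1/2" using that by simp
    have "w = x + (1 + 1 / (4 * s)) *\<^sub>R (y - x)"
      by (simp add: w_def algebra_simps)
    moreover have "(1 - t) *\<^sub>R x + t *\<^sub>R (x + c *\<^sub>R d) = x + (t * c) *\<^sub>R d" for c d
      by (simp add: algebra_simps)
    ultimately have "(1 - t) *\<^sub>R x + t *\<^sub>R w = x + (t * (1 + 1 / (4 * s))) *\<^sub>R (y - x)"
      by metis
    also have "\<dots> = y"
      using t(4) by simp
    finally have y: "(1 - t) *\<^sub>R x + t *\<^sub>R w = y" .
    have "f y \<le> (1 - t) * f x + t * f w"
      using convex_onD[OF f, of t x w] t that w y by simp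
    then have "f y - f x \<le> t * (f w - f x)"
      by (simp add: algebra_simps)
    also have "\<dots> \<le> t * (2 * M)"
      using M[OF w] M[of x] that t by (intro mult_left_mono) auto
    also have "\<dots> \<le> (4 * s) * (2 * M)"
      using t M[OF w] by (intro mult_right_mono) auto
    finally show ?thesis by (simp add: s_def mult_ac)
  qed
  from this[of x y] this[of y x] show ?thesis
    using xy by (cases "x = y") (auto simp: norm_minus_commute abs_le_iff)
qed

lemma convex_difference_quotient_mono:
  fixes f :: "'a::real_vector \<Rightarrow> real"
  assumes f: "convex_on A f" and "0 \<in> A" "t *\<^sub>R v \<in> A" and "f 0 = 0" and "0 < s" "s \<le> t"
  shows "f (s *\<^sub>R v) / s \<le> f (t *\<^sub>R v) / t"
proof -
  have st: "0 \<le> s / t" "s / t \<le> 1" "(s / t) *\<^sub>R (t *\<^sub>R v) = s *\<^sub>R v"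
    using \<open>0 < s\<close> \<open>s \<le> t\<close> by simp_all
  have "f (s *\<^sub>R v) \<le> s / t * f (t *\<^sub>R v)"
    using convex_onD[OF f st(1,2) \<open>0 \<in> A\<close> \<open>t *\<^sub>R v \<in> A\<close>] unfolding st(3) by (simp add: \<open>f 0 = 0\<close>)
  then show ?thesis
    using \<open>0 < s\<close> by (simp add: pos_divide_le_eq mult.commute)
qed

text \<open>
  The difference quotient along a ray decreases with the step and is bounded below by the Lipschitz
  bound, so it converges as the step tends to zero.
\<close>

lemma convex_difference_quotient_Cauchy:
  fixes f :: "'a::euclidean_space \<Rightarrow> real"
  assumes f: "convex_on (ball 0 1) f" and "f 0 = 0" and v: "norm v \<le> 1" and "\<eta> > 0"
  obtains t\<^sub>0 where "0 < t\<^sub>0"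
    "\<And>s t. \<lbrakk>0 < s; s \<le> t\<^sub>0; 0 < t; t \<le> t\<^sub>0\<rbrakk> \<Longrightarrow> f (t *\<^sub>R v) / t - f (s *\<^sub>R v) / s \<le> \<eta>"
proof -
  obtain M where M: "M > 0" "\<And>x. norm x \<le> 1/2 \<Longrightarrow> \<bar>f x\<bar> \<le> M"
    using convex_bounded_half_ball[OF f] by metis
  define q where "q t = f (t *\<^sub>R v) / t" for t
  have "- (8 * M) \<le> q t" if "t \<in> {0<..1/4}" for t
  proof -
    have "norm (t *\<^sub>R v) \<le> t" using v that by (simp add: mult_left_le)
    then have "\<bar>f (t *\<^sub>R v)\<bar> \<le> 8 * M * t"
      using convex_bounded_imp_Lipschitz[OF f M(2), of "t *\<^sub>R v" 0] that \<open>f 0 = 0\<close> M(1)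
      by (smt (verit) diff_zero greaterThanAtMost_iff mult_left_mono norm_zero)
    then show ?thesis using that by (simp add: q_def field_simps abs_le_iff)
  qed
  then have bdd: "bdd_below (q ` {0<..1/4})" by (rule bdd_belowI2)
  define g where "g = (INF t\<in>{0<..1/4}. q t)"
  have "\<exists>t\<in>{0<..1/4}. q t < g + \<eta>"
    using cINF_less_iff[OF _ bdd, of "g + \<eta>"] \<open>\<eta> > 0\<close> by (auto simp: g_def)
  then obtain t\<^sub>0 where t0: "0 < t\<^sub>0" "t\<^sub>0 \<le> 1/4" "q t\<^sub>0 < g + \<eta>" by auto
  show thesis
  proof (rule that[OF t0(1)])
    fix s t assume st: "0 < s" "s \<le> t\<^sub>0" "0 < t" "t \<le> t\<^sub>0"
    have "g \<le> q s" unfolding g_def using st t0 by (intro cINF_lower bdd) auto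
    moreover have "q t \<le> q t\<^sub>0" unfolding q_def
    proof (rule convex_difference_quotient_mono[OF f _ _ \<open>f 0 = 0\<close>])
      have "norm (t\<^sub>0 *\<^sub>R v) \<le> t\<^sub>0" using v t0 by (simp add: mult_left_le)
      then have "norm (t\<^sub>0 *\<^sub>R v) < 1" using t0 by linarith
      then show "t\<^sub>0 *\<^sub>R v \<in> ball 0 1" by simp
    qed (use st in auto)
    ultimately show "f (t *\<^sub>R v) / t - f (s *\<^sub>R v) / s \<le> \<eta>"
      using t0 by (simp add: q_def)
  qed
qed

text \<open>
  The quotients are Lipschitz functions of the direction, with a constant that does not depend on
  the step, so finitely many directions control all of them by compactness of the ball.
\<close>

lemma convex_difference_quotient_uniformly_Cauchy:
  fixes f :: "'a::euclidean_space \<Rightarrow> real"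
  assumes f: "convex_on (ball 0 1) f" and "f 0 = 0" and ab: "a > 0" "b > 0" and "\<eta> > 0"
  shows "\<exists>\<delta>>0. \<forall>z. norm z \<le> \<delta> \<longrightarrow> f (b *\<^sub>R z) / b - f (a *\<^sub>R z) / a \<le> \<eta> * norm z"
proof -
  obtain M where M: "M > 0" "\<And>x. norm x \<le> 1/2 \<Longrightarrow> \<bar>f x\<bar> \<le> M"
    using convex_bounded_half_ball[OF f] by metis
  \<comment> \<open>Moving the direction by less than \<open>\<rho>\<close> changes each of the two quotients by at most \<open>\<eta>/4\<close>.\<close>
  define \<rho> where "\<rho> = \<eta> / (32 * M)"
  have \<rho>: "\<rho> > 0" "16 * M * \<rho> = \<eta> / 2" using M \<open>\<eta> > 0\<close> by (auto simp: \<rho>_def)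
  have "\<exists>t. 0 < t \<and> (\<forall>v s r. norm v \<le> 1 \<longrightarrow> 0 < s \<longrightarrow> s \<le> t \<longrightarrow> 0 < r \<longrightarrow> r \<le> t \<longrightarrow> v \<in> ball w \<rho> 
     \<longrightarrow> f (r *\<^sub>R v) / r - f (s *\<^sub>R v) / s \<le> \<eta>)" if w: "w \<in> cball 0 1" for w
  proof -
    obtain t where t: "0 < t" 
      "\<And>s r. \<lbrakk>0 < s; s \<le> t; 0 < r; r \<le> t\<rbrakk> \<Longrightarrow> f (r *\<^sub>R w) / r - f (s *\<^sub>R w) / s \<le> \<eta> / 2"
      using convex_difference_quotient_Cauchy[OF f \<open>f 0 = 0\<close>, of w "\<eta>/2"] w \<open>\<eta> > 0\<close> by auto
    have lip: "\<bar>f (s *\<^sub>R v) / s - f (s *\<^sub>R w) / s\<bar> \<le> 8 * M * \<rho>"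
      if "norm v \<le> 1" "0 < s" "s \<le> 1/4" "v \<in> ball w \<rho>" for s v
    proof -
      have small: "norm (s *\<^sub>R x) \<le> 1/4" if "norm x \<le> 1" for x :: 'a
      proof -
        have "norm (s *\<^sub>R x) \<le> s" using \<open>0 < s\<close> that by (simp add: mult_left_le)
        then show ?thesis using \<open>s \<le> 1/4\<close> by linarith
      qed
      have "norm w \<le> 1" using w by simp
      from small[OF that(1)] small[OF this] have "\<bar>f (s *\<^sub>R v) - f (s *\<^sub>R w)\<bar> \<le> 8 * M * norm (s *\<^sub>R v - s *\<^sub>R w)"
        by (intro convex_bounded_imp_Lipschitz[OF f]) (simp_all add: M(2))
      also have "\<dots> = s * (8 * M * dist v w)"
        using that by (simp add: scaleR_diff_right[symmetric] dist_norm)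
      also have "\<dots> \<le> s * (8 * M * \<rho>)"
        using that M(1) by (intro mult_left_mono) (auto simp: dist_commute)
      finally show ?thesis
        using that by (simp add: diff_divide_distrib[symmetric] pos_divide_le_eq mult.commute)
    qed
    show ?thesis
    proof (intro exI[of _ "min t (1/4)"] conjI allI impI)
      fix v s r assume vsr: "norm v \<le> 1" "0 < s" "s \<le> min t (1/4)" "0 < r" "r \<le> min t (1/4)" "v \<in> ball w \<rho>"
      show "f (r *\<^sub>R v) / r - f (s *\<^sub>R v) / s \<le> \<eta>"
        using lip[of v s] lip[of v r] t(2)[of s r] vsr \<rho>(2) by (simp add: abs_le_iff)
    qed (use t in auto)
  qed
  then obtain \<tau> where \<tau>: "\<And>w. w \<in> cball 0 1 \<Longrightarrow> 0 < \<tau> w"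
    "\<And>w v s r. \<lbrakk>w \<in> cball 0 1; norm v \<le> 1; 0 < s; s \<le> \<tau> w; 0 < r; r \<le> \<tau> w; v \<in> ball w \<rho>\<rbrakk>
       \<Longrightarrow> f (r *\<^sub>R v) / r - f (s *\<^sub>R v) / s \<le> \<eta>"
    by metis
  obtain K where K: "K \<subseteq> cball 0 1" "finite K" "cball (0::'a) 1 \<subseteq> (\<Union>w\<in>K. ball w \<rho>)"
    using compactE_image[of "cball (0::'a) 1" "cball 0 1" "\<lambda>w. ball w \<rho>"] \<rho>(1)
    by (auto simp: subset_iff) (metis centre_in_ball mem_ball mem_cball dist_0_norm compact_cball)
  have "K \<noteq> {}" using K(3) by force
  define t where "t = Min (\<tau> ` K)"
  have t: "t > 0" "\<And>w. w \<in> K \<Longrightarrow> t \<le> \<tau> w"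
    using K \<tau>(1) \<open>K \<noteq> {}\<close> by (auto simp: t_def subset_iff)
  show ?thesis
  proof (intro exI[of _ "min (t / a) (t / b)"] conjI allI impI)
    show "0 < min (t / a) (t / b)" using t ab by simp
    fix z :: 'a assume z: "norm z \<le> min (t / a) (t / b)"
    show "f (b *\<^sub>R z) / b - f (a *\<^sub>R z) / a \<le> \<eta> * norm z"
    proof (cases "z = 0")
      case True then show ?thesis using \<open>f 0 = 0\<close> by simp
    next
      case False
      define v where "v = z /\<^sub>R norm z"
      have v: "norm v = 1" "z = norm z *\<^sub>R v" using False by (auto simp: v_def)
      then have "v \<in> cball 0 1" by simp
      then obtain w where w: "w \<in> K" "v \<in> ball w \<rho>" using K(3) by blast
      have "a * norm z \<le> t" "b * norm z \<le> t" using z ab by (simp_all add: field_simps)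
      then have "f ((b * norm z) *\<^sub>R v) / (b * norm z) - f ((a * norm z) *\<^sub>R v) / (a * norm z) \<le> \<eta>"
        using w K(1) v(1) ab False t(2)[OF w(1)] by (intro \<tau>(2)[of w]) auto
      then have "f (b *\<^sub>R z) / (b * norm z) - f (a *\<^sub>R z) / (a * norm z) \<le> \<eta>"
        by (simp add: v(2)[symmetric] flip: scaleR_scaleR)
      moreover have "f (b *\<^sub>R z) / (b * norm z) - f (a *\<^sub>R z) / (a * norm z)
          = (f (b *\<^sub>R z) / b - f (a *\<^sub>R z) / a) / norm z"
        by (simp add: diff_divide_distrib)
      ultimately show ?thesis using False by (simp add: pos_divide_le_eq)
    qed
  qed
qed

section \<open>Subgradients near a subspace on which the function vanishes\<close>

text \<open>
  The point \<open>u + z\<close> lies on a segment from a zero of \<open>h\<close> in \<open>W\<close> to \<open>4 z\<close>, and \<open>z / 4\<close> lies on one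
  from another zero to \<open>u + z\<close>, each time at three quarters of the way towards the zero. Neither
  bound involves \<open>u\<close>.
\<close>

lemma convex_vanishing_on_subspace_oscillation:
  fixes h :: "'a::euclidean_space \<Rightarrow> real"
  assumes h: "convex_on (ball 0 1) h" and "subspace W"
    and zero: "\<And>x. \<lbrakk>x \<in> W; norm x < 1\<rbrakk> \<Longrightarrow> h x = 0"
    and u: "u \<in> W" "norm u \<le> 1/4" and z: "norm z \<le> 1/8"
  shows "h (u + z) \<le> h (4 *\<^sub>R z) / 4" and "4 * h ((1/4) *\<^sub>R z) \<le> h (u + z)"
proof -
  have W: "(4/3) *\<^sub>R u \<in> W" "(-1/3) *\<^sub>R u \<in> W"
    using u \<open>subspace W\<close> by (auto intro!: subspace_scale subspace_neg)
  have "(1 - 1/4) *\<^sub>R ((4/3) *\<^sub>R u) + (1/4) *\<^sub>R (4 *\<^sub>R z) = u + z"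
    by simp
  then show "h (u + z) \<le> h (4 *\<^sub>R z) / 4"
    using convex_onD[OF h, of "1/4" "(4/3) *\<^sub>R u" "4 *\<^sub>R z"] zero[OF W(1)] u z by simp
  have "(1 - 1/4) *\<^sub>R ((-1/3) *\<^sub>R u) + (1/4) *\<^sub>R (u + z) = (1/4) *\<^sub>R z"
    by (simp add: algebra_simps)
  moreover have "norm (u + z) < 1"
    using norm_triangle_ineq[of u z] u z by simp
  ultimately show "4 * h ((1/4) *\<^sub>R z) \<le> h (u + z)"
    using convex_onD[OF h, of "1/4" "(-1/3) *\<^sub>R u" "u + z"] zero[OF W(2)] u by simp
qed

lemma subdifferential_norm_le:
  assumes M: "\<And>x. norm x \<le> 1/2 \<Longrightarrow> \<bar>h x\<bar> \<le> M" and "norm x \<le> 1/4"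
    and p: "p \<in> subdifferential h x"
  shows "norm p \<le> 8 * M"
proof (cases "p = 0")
  case True
  then show ?thesis using M[of 0] by simp
next
  case False
  define y where "y = x + (1 / (4 * norm p)) *\<^sub>R p"
  have "norm y \<le> norm x + norm ((1 / (4 * norm p)) *\<^sub>R p)"
    unfolding y_def by (rule norm_triangle_ineq)
  then have y: "norm y \<le> 1/2" using False \<open>norm x \<le> 1/4\<close> by simp
  then have "h x + p \<bullet> (y - x) \<le> h y"
    using p by (auto simp: subdifferential_def)
  moreover have "p \<bullet> (y - x) = norm p / 4"
    using False by (simp add: y_def power2_norm_eq_inner[symmetric] power2_eq_square)
  ultimately show ?thesis
    using M[OF y] M[of x] \<open>norm x \<le> 1/4\<close> by (simp add: abs_le_iff)
qed

text \<open>
  Test the subgradient inequality at \<open>u + z + e/8\<close>: there \<open>h\<close> exceeds its value at \<open>u + z\<close> by at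
  most the oscillation of \<open>h\<close> along the translate of \<open>W\<close> through \<open>z\<close>.
\<close>

lemma subdifferential_tangential_le:
  fixes h :: "real ^ 'd::finite \<Rightarrow> real"
  assumes h: "convex_on (ball 0 1) h" and "subspace W"
    and zero: "\<And>x. \<lbrakk>x \<in> W; norm x < 1\<rbrakk> \<Longrightarrow> h x = 0"
    and u: "u \<in> W" "norm u \<le> 1/8" and z: "norm z \<le> 1/8"
    and p: "p \<in> subdifferential h (u + z)" and e: "e \<in> W" "norm e = 1"
  shows "\<bar>p \<bullet> e\<bar> \<le> 8 * (h (4 *\<^sub>R z) / 4 - h ((1/4) *\<^sub>R z) / (1/4))"
proof -
  have *: "p \<bullet> e \<le> 8 * (h (4 *\<^sub>R z) / 4 - h ((1/4) *\<^sub>R z) / (1/4))"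
    if e: "e \<in> W" "norm e = 1" for e
  proof -
    define u' where "u' = u + (1/8) *\<^sub>R e"
    have u': "u' \<in> W" "norm u' \<le> 1/4"
    proof -
      show "u' \<in> W"
        unfolding u'_def using e u \<open>subspace W\<close> by (intro subspace_add subspace_scale)
      show "norm u' \<le> 1/4"
        using norm_triangle_ineq[of u "(1/8) *\<^sub>R e"] e u by (simp add: u'_def)
    qed
    have "norm (u' + z) < 1" using norm_triangle_ineq[of u' z] u' z by simp
    then have "u' + z \<in> ball 0 1" by simp
    with p have "h (u + z) + p \<bullet> ((u' + z) - (u + z)) \<le> h (u' + z)"
      unfolding subdifferential_def by blast
    moreover have "h (u' + z) \<le> h (4 *\<^sub>R z) / 4"
      using convex_vanishing_on_subspace_oscillation(1)[OF h \<open>subspace W\<close> zero] u' z by blast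
    moreover have "4 * h ((1/4) *\<^sub>R z) \<le> h (u + z)"
      using convex_vanishing_on_subspace_oscillation(2)[OF h \<open>subspace W\<close> zero, of u z] u z by simp
    ultimately show ?thesis by (simp add: u'_def)
  qed
  show ?thesis
    using *[OF e] *[of "- e"] e \<open>subspace W\<close> by (simp add: subspace_neg abs_le_iff)
qed

text \<open>
  The order of quantifiers is what matters: \<open>C\<close> is chosen before \<open>\<tau>\<close>, so the image becomes
  arbitrarily thin along \<open>W\<close> compared with \<open>\<epsilon>\<close> while its other widths stay bounded. The value of \<open>r\<close>
  keeps the part of the prism in \<open>W\<close> within distance \<open>1/8\<close> of the origin.
\<close>

lemma subdifferential_image_in_thin_box:
  fixes h :: "real ^ 'd::finite \<Rightarrow> real"
  assumes h: "convex_on (ball 0 1) h" and W: "subspace W"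
    and zero: "\<And>x. \<lbrakk>x \<in> W; norm x < 1\<rbrakk> \<Longrightarrow> h x = 0"
    and \<beta>: "\<And>i. norm (\<beta> i) = 1" "\<And>i j. i \<noteq> j \<Longrightarrow> orthogonal (\<beta> i) (\<beta> j)"
    and I: "\<And>i. i \<in> I \<Longrightarrow> \<beta> i \<in> W"
    and r: "r = 1 / (8 * real CARD('d))"
  shows "\<exists>C>0. \<forall>\<tau>>0. \<exists>\<epsilon>. 0 < \<epsilon> \<and> \<epsilon> \<le> 1 \<and>
      frame_box \<beta> (\<lambda>i. if i \<in> I then r else \<epsilon>) \<subseteq> ball 0 1 \<and>
      (\<Union>x\<in>frame_box \<beta> (\<lambda>i. if i \<in> I then r else \<epsilon>). subdifferential h x)
        \<subseteq> frame_box \<beta> (\<lambda>i. if i \<in> I then \<tau> * \<epsilon> / 2 else C)"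
proof -
  obtain M where M: "M > 0" "\<And>x. norm x \<le> 1/2 \<Longrightarrow> \<bar>h x\<bar> \<le> M"
    using convex_bounded_half_ball[OF h] by metis
  define n where "n = real CARD('d)"
  have n: "n > 0" by (simp add: n_def)
  have coords: "norm (\<Sum>i\<in>J. (\<beta> i \<bullet> x) *\<^sub>R \<beta> i) \<le> n * b"
    if "\<And>i. i \<in> J \<Longrightarrow> \<bar>\<beta> i \<bullet> x\<bar> \<le> b" "b \<ge> 0" for J x b
  proof -
    have "norm (\<Sum>i\<in>J. (\<beta> i \<bullet> x) *\<^sub>R \<beta> i) \<le> (\<Sum>i\<in>J. b)"
      using that by (intro sum_norm_le) (simp add: \<beta>(1))
    also have "\<dots> \<le> n * b"
      using that(2) by (auto simp: n_def intro!: mult_right_mono card_mono)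
    finally show ?thesis .
  qed
  show ?thesis
  proof (rule exI[of _ "8 * M + 1"], intro conjI allI impI)
    fix \<tau> :: real assume "\<tau> > 0"
    then have "\<tau> / (32 * n) > 0" using n by simp
    moreover have "h 0 = 0" using zero[of 0] W by (simp add: subspace_0)
    ultimately have "\<exists>\<delta>>0. \<forall>z. norm z \<le> \<delta> \<longrightarrow>
        h (4 *\<^sub>R z) / 4 - h ((1/4) *\<^sub>R z) / (1/4) \<le> \<tau> / (32 * n) * norm z"
      by (intro convex_difference_quotient_uniformly_Cauchy h) simp_all
    then obtain \<delta> where \<delta>: "\<delta> > 0"
      "\<And>z. norm z \<le> \<delta> \<Longrightarrow> h (4 *\<^sub>R z) / 4 - h ((1/4) *\<^sub>R z) / (1/4) \<le> \<tau> / (32 * n) * norm z"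
      by blast
    define \<epsilon> where "\<epsilon> = min 1 (min \<delta> (1/8) / n)"
    have \<epsilon>: "0 < \<epsilon>" "\<epsilon> \<le> 1"
      using \<delta> n by (auto simp: \<epsilon>_def)
    have "n * \<epsilon> \<le> n * (min \<delta> (1/8) / n)" unfolding \<epsilon>_def using n by (intro mult_left_mono) auto
    then have n\<epsilon>: "n * \<epsilon> \<le> \<delta>" "n * \<epsilon> \<le> 1/8" using n by auto
    define S where "S = frame_box \<beta> (\<lambda>i. if i \<in> I then r else \<epsilon>)"
    have split: "\<exists>u z. x = u + z \<and> u \<in> W \<and> norm u \<le> 1/8 \<and> norm z \<le> n * \<epsilon>" if "x \<in> S" for x
    proof (intro exI conjI)
      let ?u = "\<Sum>i\<in>I. (\<beta> i \<bullet> x) *\<^sub>R \<beta> i" and ?z = "\<Sum>i\<in>-I. (\<beta> i \<bullet> x) *\<^sub>R \<beta> i"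
      have "(\<Sum>i\<in>UNIV. (\<beta> i \<bullet> x) *\<^sub>R \<beta> i) = ?u + ?z"
        by (subst sum.union_disjoint[symmetric]) auto
      then show "x = ?u + ?z" using orthonormal_frame_expand[of \<beta> x] \<beta> by simp
      show "?u \<in> W" by (intro subspace_sum[OF W] subspace_scale[OF W] I)
      have bound: "\<bar>\<beta> i \<bullet> x\<bar> \<le> (if i \<in> I then r else \<epsilon>)" for i
        using \<open>x \<in> S\<close> unfolding S_def frame_box_def by (blast intro: less_imp_le)
      have "norm ?u \<le> n * r"
      proof (rule coords)
        show "\<bar>\<beta> i \<bullet> x\<bar> \<le> r" if "i \<in> I" for i using bound[of i] that by simp
      qed (simp add: r)
      also have "n * r = 1/8" using n by (simp add: r n_def)
      finally show "norm ?u \<le> 1/8" .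
      show "norm ?z \<le> n * \<epsilon>"
      proof (rule coords)
        show "\<bar>\<beta> i \<bullet> x\<bar> \<le> \<epsilon>" if "i \<in> - I" for i using bound[of i] that by simp
      qed (use \<epsilon> in simp)
    qed
    have norm_S: "norm x \<le> 1/4" if x: "x \<in> S" for x
    proof -
      obtain u z where "x = u + z" "norm u \<le> 1/8" "norm z \<le> n * \<epsilon>"
        using split[OF x] by blast
      then show ?thesis using norm_triangle_ineq[of u z] n\<epsilon> by simp
    qed
    have "S \<subseteq> ball 0 1" using norm_S by fastforce
    moreover have "\<bar>\<beta> i \<bullet> p\<bar> < (if i \<in> I then \<tau> * \<epsilon> / 2 else 8 * M + 1)"
      if x: "x \<in> S" and p: "p \<in> subdifferential h x" for x p i
    proof (cases "i \<in> I")
      case True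
      obtain u z where uz: "x = u + z" "u \<in> W" "norm u \<le> 1/8" "norm z \<le> n * \<epsilon>"
        using split[OF x] by blast
      have "\<bar>p \<bullet> \<beta> i\<bar> \<le> 8 * (h (4 *\<^sub>R z) / 4 - h ((1/4) *\<^sub>R z) / (1/4))"
        using subdifferential_tangential_le[OF h W zero uz(2,3)] uz(4) n\<epsilon>(2) p uz(1) I[OF True] \<beta>(1)
        by simp
      also have "\<dots> \<le> 8 * (\<tau> / (32 * n) * norm z)"
        using \<delta>(2)[of z] uz(4) n\<epsilon>(1) by (intro mult_left_mono) auto
      also have "\<dots> \<le> 8 * (\<tau> / (32 * n) * (n * \<epsilon>))"
        using uz(4) n \<open>\<tau> > 0\<close> by (intro mult_left_mono) auto
      also have "\<dots> = \<tau> * \<epsilon> / 4" using n by simp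
      also have "\<dots> < \<tau> * \<epsilon> / 2" using \<open>\<tau> > 0\<close> \<epsilon> by simp
      finally show ?thesis using True by (simp add: inner_commute)
    next
      case False
      have "\<bar>\<beta> i \<bullet> p\<bar> \<le> norm p" using Cauchy_Schwarz_ineq2[of "\<beta> i" p] by (simp add: \<beta>(1))
      also have "\<dots> \<le> 8 * M"
        using subdifferential_norm_le[of h M x p] M(2) norm_S[OF x] p by blast
      finally show ?thesis using False by simp
    qed
    ultimately show "\<exists>\<epsilon>. 0 < \<epsilon> \<and> \<epsilon> \<le> 1 \<and>
      frame_box \<beta> (\<lambda>i. if i \<in> I then r else \<epsilon>) \<subseteq> ball 0 1 \<and>
      (\<Union>x\<in>frame_box \<beta> (\<lambda>i. if i \<in> I then r else \<epsilon>). subdifferential h x)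
        \<subseteq> frame_box \<beta> (\<lambda>i. if i \<in> I then \<tau> * \<epsilon> / 2 else 8 * M + 1)"
      using \<epsilon> unfolding S_def frame_box_def by (intro exI[of _ \<epsilon>] conjI) blast+
  qed (use M in auto)
qed

section \<open>Comparison of volumes\<close>

text \<open>
  With \<open>m = dim W\<close> and \<open>k\<close> its codimension, the prism has volume of order \<open>\<epsilon> ^ k\<close> and its gradient
  image has volume at most of order \<open>(\<tau> * \<epsilon>) ^ m\<close>. Since \<open>k \<le> m\<close>, \<open>0 < m\<close> and \<open>\<epsilon> \<le> 1\<close>, the latter is at
  most of order \<open>\<tau> * \<epsilon> ^ k\<close>, and \<open>\<tau>\<close> can be chosen small depending on \<open>c\<close>.
\<close>

lemma monge_ampere_small_if_vanishing_on_subspace: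
  fixes h :: "real ^ 'd::finite \<Rightarrow> real"
  assumes h: "convex_on (ball 0 1) h" and W: "subspace W"
    and dim: "dim W > 0" "CARD('d) - dim W \<le> dim W"
    and zero: "\<And>x. \<lbrakk>x \<in> W; norm x < 1\<rbrakk> \<Longrightarrow> h x = 0"
    and "c > 0"
  obtains \<omega> where "\<omega> \<in> sets borel" "\<omega> \<subseteq> ball 0 1"
    "monge_ampere h \<omega> < ennreal c * emeasure lebesgue \<omega>"
proof -
  obtain \<beta> :: "'d \<Rightarrow> real ^ 'd" and I where \<beta>: "\<And>i. norm (\<beta> i) = 1"
    "\<And>i j. i \<noteq> j \<Longrightarrow> orthogonal (\<beta> i) (\<beta> j)" and I: "\<And>i. i \<in> I \<Longrightarrow> \<beta> i \<in> W" "card I = dim W"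
    using orthonormal_frame_adapted_to_subspace[OF W] by metis
  define m k where "m = dim W" and "k = CARD('d) - dim W"
  have prod_if: "(\<Prod>i\<in>UNIV. 2 * (if i \<in> I then a else b)) = (2 * a) ^ m * (2 * b) ^ k" for a b :: real
    by (simp add: if_distrib[of "\<lambda>x. 2 * x"] prod.If_cases I(2) m_def k_def card_Diff_subset
        Compl_eq_Diff_UNIV cong: if_cong)
  define r where "r = 1 / (8 * real CARD('d))"
  have "r > 0" by (simp add: r_def)
  obtain C where C: "C > 0" and thin: "\<And>\<tau>. \<tau> > 0 \<Longrightarrow> \<exists>\<epsilon>. 0 < \<epsilon> \<and> \<epsilon> \<le> 1 \<and>
      frame_box \<beta> (\<lambda>i. if i \<in> I then r else \<epsilon>) \<subseteq> ball 0 1 \<and>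
      (\<Union>x\<in>frame_box \<beta> (\<lambda>i. if i \<in> I then r else \<epsilon>). subdifferential h x)
        \<subseteq> frame_box \<beta> (\<lambda>i. if i \<in> I then \<tau> * \<epsilon> / 2 else C)"
    using subdifferential_image_in_thin_box[where \<beta> = \<beta> and I = I, OF h W zero \<beta> I(1) r_def] by blast
  \<comment> \<open>The volume of the prism, scaled by \<open>c\<close>, is \<open>\<kappa> * \<epsilon> ^ k\<close>, and that of the box around its gradient
    image is \<open>(\<tau> * \<epsilon>) ^ m * D\<close>.\<close>
  define \<kappa> where "\<kappa> = c * ((2 * r) ^ m * 2 ^ k)"
  define D where "D = (2 * C) ^ k"
  have "\<kappa> > 0" "D > 0" using \<open>c > 0\<close> \<open>r > 0\<close> C by (simp_all add: \<kappa>_def D_def)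
  define \<tau> where "\<tau> = min 1 (\<kappa> / (2 * D))"
  have \<tau>: "0 < \<tau>" "\<tau> \<le> 1" using \<open>\<kappa> > 0\<close> \<open>D > 0\<close> by (simp_all add: \<tau>_def)
  have "\<tau> * D \<le> \<kappa> / (2 * D) * D" unfolding \<tau>_def using \<open>D > 0\<close> by (intro mult_right_mono) auto
  also have "\<dots> < \<kappa>" using \<open>\<kappa> > 0\<close> \<open>D > 0\<close> by simp
  finally have "\<tau> * D < \<kappa>" .
  obtain \<epsilon> where \<epsilon>: "0 < \<epsilon>" "\<epsilon> \<le> 1"
    and sub: "frame_box \<beta> (\<lambda>i. if i \<in> I then r else \<epsilon>) \<subseteq> ball 0 1"
    and img: "(\<Union>x\<in>frame_box \<beta> (\<lambda>i. if i \<in> I then r else \<epsilon>). subdifferential h x)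
        \<subseteq> frame_box \<beta> (\<lambda>i. if i \<in> I then \<tau> * \<epsilon> / 2 else C)"
    using thin[OF \<tau>(1)] by blast
  define \<omega> where "\<omega> = frame_box \<beta> (\<lambda>i. if i \<in> I then r else \<epsilon>)"
  define P where "P = frame_box \<beta> (\<lambda>i. if i \<in> I then \<tau> * \<epsilon> / 2 else C)"
  have "0 < (if i \<in> I then r else \<epsilon>)" "0 < (if i \<in> I then \<tau> * \<epsilon> / 2 else C)" for i
    using \<open>r > 0\<close> \<epsilon> \<tau> C by auto
  then have \<omega>: "emeasure lebesgue \<omega> = ennreal ((2 * r) ^ m * (2 * \<epsilon>) ^ k)"
    and P: "emeasure lebesgue P = ennreal ((2 * (\<tau> * \<epsilon> / 2)) ^ m * (2 * C) ^ k)"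
    unfolding \<omega>_def P_def prod_if[symmetric]
    by (intro emeasure_frame_box; simp add: \<beta>)+
  have "(\<tau> * \<epsilon>) ^ m = \<tau> ^ m * \<epsilon> ^ m" by (rule power_mult_distrib)
  also have "\<dots> \<le> \<tau> * \<epsilon> ^ k"
    using dim \<tau> \<epsilon> power_decreasing[of 1 m \<tau>] power_decreasing[of k m \<epsilon>]
    by (intro mult_mono) (auto simp: m_def k_def)
  finally have "(\<tau> * \<epsilon>) ^ m * D \<le> \<tau> * \<epsilon> ^ k * D"
    using \<open>D > 0\<close> by (intro mult_right_mono) auto
  also have "\<dots> < \<kappa> * \<epsilon> ^ k"
    using mult_strict_right_mono[OF \<open>\<tau> * D < \<kappa>\<close>, of "\<epsilon> ^ k"] \<epsilon> by (simp add: mult_ac)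
  also have "\<dots> = c * ((2 * r) ^ m * (2 * \<epsilon>) ^ k)"
    by (simp add: \<kappa>_def power_mult_distrib)
  finally have vol: "(2 * (\<tau> * \<epsilon> / 2)) ^ m * (2 * C) ^ k < c * ((2 * r) ^ m * (2 * \<epsilon>) ^ k)"
    by (simp add: D_def)
  show thesis
  proof (rule that[of \<omega>])
    show "\<omega> \<in> sets borel" "\<omega> \<subseteq> ball 0 1" using sub by (simp_all add: \<omega>_def borel_open open_frame_box)
    have "monge_ampere h \<omega> \<le> emeasure lebesgue P"
      unfolding monge_ampere_def
    proof (rule emeasure_mono)
      show "(\<Union>x\<in>\<omega>. subdifferential h x) \<subseteq> P" using img by (simp add: \<omega>_def P_def)
      show "P \<in> sets lebesgue" using open_frame_box[of \<beta>] by (simp add: P_def)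
    qed
    also have "\<dots> < ennreal (c * ((2 * r) ^ m * (2 * \<epsilon>) ^ k))"
      unfolding P using vol \<open>c > 0\<close> \<open>r > 0\<close> \<epsilon>(1) by (intro ennreal_lessI mult_pos_pos zero_less_power) simp_all
    also have "\<dots> = ennreal c * emeasure lebesgue \<omega>"
      unfolding \<omega> using \<open>c > 0\<close> \<open>r > 0\<close> \<epsilon> by (intro ennreal_mult) auto
    finally show "monge_ampere h \<omega> < ennreal c * emeasure lebesgue \<omega>" .
  qed
qed

section \<open>Vanishing on the section\<close>

lemma unit_sphere_subset_frontier_of_ball_section:
  fixes W :: "'a::real_normed_vector set"
  assumes "subspace W" "x \<in> W" "norm x = 1"
  shows "x \<in> top_of_set W frontier_of (W \<inter> ball 0 1)"
proof -
  have "x islimpt (W \<inter> ball 0 1)"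
    unfolding islimpt_approachable
  proof (intro allI impI)
    fix e :: real assume "e > 0"
    define t where "t = max (1/2) (1 - e/2)"
    have t: "0 < t" "t < 1" "1 - t < e" using \<open>e > 0\<close> by (auto simp: t_def)
    have "t *\<^sub>R x \<in> W \<inter> ball 0 1" using assms t by (auto simp: subspace_scale)
    moreover have "dist (t *\<^sub>R x) x = 1 - t"
    proof -
      have "t *\<^sub>R x - x = (t - 1) *\<^sub>R x" by (simp add: algebra_simps)
      then show ?thesis using t assms by (simp add: dist_norm)
    qed
    ultimately show "\<exists>y\<in>W \<inter> ball 0 1. y \<noteq> x \<and> dist y x < e"
      using t by (intro bexI[of _ "t *\<^sub>R x"]) auto
  qed
  then have "x \<in> closure (W \<inter> ball 0 1)" by (simp add: closure_def)
  then have "x \<in> top_of_set W closure_of (W \<inter> ball 0 1)"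
    using assms(2) by (simp add: closure_of_subtopology Int_absorb1)
  moreover have "x \<notin> top_of_set W interior_of (W \<inter> ball 0 1)"
    using interior_of_subset[of "top_of_set W" "W \<inter> ball 0 1"] assms(3) by auto
  ultimately show ?thesis by (simp add: frontier_of_def)
qed

text \<open>
  On a diameter of the section \<open>h\<close> is convex with value zero at both ends, hence nonpositive, and a
  negative value anywhere inside would force \<open>h 0 < 0\<close>. The vector \<open>v\<close> supplies a diameter through
  \<open>x\<close> when \<open>x = 0\<close>.
\<close>

lemma convex_zero_on_section_if_zero_on_sphere:
  fixes h :: "'a::real_normed_vector \<Rightarrow> real"
  assumes h: "convex_on (cball 0 1) h" and W: "subspace W"
    and zero: "\<And>x. \<lbrakk>x \<in> W; norm x = 1\<rbrakk> \<Longrightarrow> h x = 0" and "h 0 \<ge> 0"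
    and v: "v \<in> W" "norm v = 1" and x: "x \<in> W" "norm x < 1"
  shows "h x = 0"
proof -
  obtain e s where e: "e \<in> W" "norm e = 1" and s: "0 \<le> s" "s < 1" "x = s *\<^sub>R e"
  proof (cases "x = 0")
    case True
    then show thesis using that[of v 0] v by simp
  next
    case False
    then show thesis
      using that[of "x /\<^sub>R norm x" "norm x"] x W by (simp add: subspace_scale)
  qed
  have he: "h e = 0" "h (- e) = 0" using zero e W by (simp_all add: subspace_neg)
  have "(1 - (1 + s) / 2) *\<^sub>R (- e) + ((1 + s) / 2) *\<^sub>R e = x"
    by (simp add: s(3) flip: scaleR_left_diff_distrib scaleR_add_left)
  then have "h x \<le> 0"
    using convex_onD[OF h, of "(1 + s) / 2" "- e" e] s(1,2) e he by simp
  have "(1 - 1 / (1 + s)) *\<^sub>R (- e) + (1 / (1 + s)) *\<^sub>R x = 0"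
    using s by (simp add: s(3) field_simps flip: scaleR_add_left scaleR_left_diff_distrib)
  then have "h 0 \<le> 1 / (1 + s) * h x"
    using convex_onD[OF h, of "1 / (1 + s)" "- e" x] s(1,2) e he x by simp
  with \<open>h 0 \<ge> 0\<close> have "0 \<le> h x / (1 + s)" by simp
  with s(1) have "h x \<ge> 0" by (simp add: zero_le_divide_iff)
  with \<open>h x \<le> 0\<close> show ?thesis by simp
qed

theorem theorem2p34:
  fixes h :: "real ^ 'd \<Rightarrow> real"
    and c\<^sub>0 :: real
    and W :: "(real ^ 'd) set"
    and k :: nat
  assumes "CARD('d) \<ge> 2"
    and "convex_on (cball 0 1) h"
    and "c\<^sub>0 > 0"
    and "\<And>\<omega>. \<omega> \<in> sets borel \<Longrightarrow> \<omega> \<subseteq> ball 0 1 \<Longrightarrow>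
           monge_ampere h \<omega> \<ge> ennreal c\<^sub>0 * emeasure lebesgue \<omega>"
    and "affine W" and "0 \<in> W"
    and "aff_dim W = int CARD('d) - int k"
    and "real k \<le> real CARD('d) / 2"
    and "\<And>x. x \<in> top_of_set W frontier_of (W \<inter> ball 0 1) \<Longrightarrow> h x = 0"
  shows "h 0 < 0"
proof (rule ccontr)
  assume "\<not> h 0 < 0"
  have W: "subspace W" using \<open>affine W\<close> \<open>0 \<in> W\<close> by (simp add: subspace_affine)
  have "int (dim W) = int CARD('d) - int k"
    using aff_dim_subspace[OF W] assms(7) by simp
  then have dim: "dim W > 0" "CARD('d) - dim W \<le> dim W"
    using assms(1,8) by linarith+
  obtain v where v: "v \<in> W" "norm v = 1"
  proof -
    obtain w where "w \<in> W" "w \<noteq> 0" using dim(1) by (metis dim_eq_0 less_irrefl subsetI singleton_iff)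
    then show thesis using that[of "w /\<^sub>R norm w"] W by (simp add: subspace_scale)
  qed
  have "h x = 0" if "x \<in> W" "norm x < 1" for x
    using convex_zero_on_section_if_zero_on_sphere[OF assms(2) W _ _ v that] assms(9)
      unit_sphere_subset_frontier_of_ball_section[OF W] \<open>\<not> h 0 < 0\<close> by force
  moreover have "convex_on (ball 0 1) h"
    using convex_on_subset[OF assms(2) ball_subset_cball] by simp
  ultimately obtain \<omega> where "\<omega> \<in> sets borel" "\<omega> \<subseteq> ball 0 1"
    "monge_ampere h \<omega> < ennreal c\<^sub>0 * emeasure lebesgue \<omega>"
    using monge_ampere_small_if_vanishing_on_subspace[OF _ W dim _ \<open>c\<^sub>0 > 0\<close>, of h] by metis
  then show False using assms(4)[of \<omega>] by (simp add: not_le[symmetric])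
qed

end
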